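(* Let $k,\ N$ be any natural numbers greater $1$. Then for $\mathrm{Re} (x)>0$, we have \begin{align*} \mathfrak{F}_{k,N}(x)=\frac{(-1)^k}{N}x^{\frac{k-1}{N}}\sum_{\substack{j=-(N-1)\\ j\equiv N-1 \ (\mathrm{mod}\ 2)}}^{N-1}e^{\frac{i\pi j(k-1)}{N}}\mathfrak{F}_{\frac{N+k-1}{N},\frac{1}{N}}\left(\frac{e^{-\frac{i\pi j}{N}}}{x^{1/N}}\right)-\frac{x^{\frac{k-1}{N}}}{N}\mathscr{R}_{N,k}(x), \end{align*} where, for $N\nmid (k-1)$ and $N\nmid k$, \begin{align*} \mathscr{R}_{N,k}(x)&=\frac{N}{2}x^{\frac{1-k-N}{N}}\zeta(k+N)-\frac{\pi\zeta\left(\frac{N+k-1}{N}\right)}{\sin\left(\frac{\pi}{N}(k-1)\right)}-Nx^{\frac{1-k}{N}}\left(N\zeta'(k)-(\gamma+\log x)\zeta(k)\right)\nonumber\\ &\qquad +N\sum_{j=1}^{\lfloor\frac{k-1}{N}\rfloor}(-1)^j\zeta(1+j)\zeta(k-N)x^{\frac{k-1}{N}+j}, \end{align*} and, for $N|k$, \begin{align*} \mathscr{R}_{N,k}(x)&=\frac{N}{2}x^{\frac{1-k-N}{N}}\zeta(k+N)-\frac{\pi\zeta\left(\frac{N+k-1}{N}\right)}{\sin\left(\frac{\pi}{N}(k-1)\right)}-Nx^{\frac{1-k}{N}}\left(N\zeta'(k)-(\gamma+\log x)\zeta(k)\right)\nonumber\\ &\quad-\frac{N}{2}(-1)^{\frac{k}{N}}x^{\frac{1}{N}}\zeta\left(\frac{k+N}{N}\right)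 +N\sum_{j=1}^{\lfloor\frac{k-1}{N}\rfloor}(-1)^j\zeta(1+j)\zeta(k-N)x^{\frac{k-1}{N}+j}, \end{align*} and, for $N|(k-1)$, \begin{align*} \mathscr{R}_{N,k}(x)&=\frac{N}{2}x^{\frac{1-k-N}{N}}\zeta(k+N)+(-1)^{\frac{k-1}{N}}\left((N\gamma-\log x)\zeta\left(\frac{N+k-1}{N}\right)-\zeta'\left(\frac{N+k-1}{N}\right)\right)\nonumber\\ &\quad -Nx^{\frac{1-k}{N}}\left(N\zeta'(k)-(\gamma+\log x)\zeta(k)\right)+N\sum_{j=1}^{\lfloor\frac{k-1}{N}\rfloor-1}(-1)^j\zeta(1+j)\zeta(k-N)x^{\frac{k-1}{N}+j}. \end{align*}
   Context: For $x\in\mathbb{C}\backslash(-\infty,0]$ and real $k,N$ with $k+2N>1$, the extended higher Herglotz function is $\mathfrak{F}_{k,N}(x):=\sum_{n=1}^\infty\frac{1}{n^k}\left(\psi\left(n^Nx\right)-\log\left(n^Nx\right)+\frac{1}{2n^Nx}\right)$, where $\psi=\Gamma'/\Gamma$ is the digamma function. $\gamma$ is Euler's constant and $\zeta$ the Riemann zeta function. The sum over $j$ in the main formula runs over $j=-(N-1),-(N-3),\dots,N-3,N-1$ (step 2).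
   Formalization: In the finite sum over j of R_{N,k}(x), in all three cases, the printed ζ(k−N) x^{(k−1)/N+j} is corrected to ζ(k−Nj) x^{(1−k)/N+j}; as printed the identity fails, e.g. for N=2, k=4, x=2. *)

theory Defs
  imports "HOL-Complex_Analysis.Complex_Analysis" "HOL-Number_Theory.Cong"
begin

(* The Dirichlet series is the Riemann zeta function only for Re s > 1.  Every zeta value and
   derivative used below is taken at a real point greater than 1. *)
definition zeta :: "complex \<Rightarrow> complex" where
  "zeta s = (\<Sum>n. 1 / of_nat (Suc n) powr s)"

(* Meaningful for k + 2 * N > 1 and x outside the half-line (-infinity, 0], where the series
   converges; powers and logarithms take their principal values throughout. *)
definition herglotz :: "real \<Rightarrow> real \<Rightarrow> complex \<Rightarrow> complex" where
  "herglotz k N x =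
    (\<Sum>n. 1 / of_real (real (Suc n) powr k) *
         (Digamma (of_real (real (Suc n) powr N) * x)
          - ln (of_real (real (Suc n) powr N) * x)
          + 1 / (2 * of_real (real (Suc n) powr N) * x)))"

(* The summand over j is N * (-1)^j * zeta(1 + j) * zeta(k - N * j) * x^((1 - k)/N + j), the residue
   contribution at s = -j of -pi * zeta(1 - s) * zeta(k + N * s) / (sin (pi * s) * x^s).  The formula
   in print has zeta(k - N) and x^((k - 1)/N + j) there; with these the identity fails as soon as the
   sum is non-empty (e.g. N = 2, k = 4).  The indices j satisfy k - N * j > 1. *)
definition herglotz_residue :: "nat \<Rightarrow> nat \<Rightarrow> complex \<Rightarrow> complex" where
  "herglotz_residue N k x =
    (if N dvd k - 1 then
       of_nat N / 2 * x powr ((1 - of_nat k - of_nat N) / of_nat N) * zeta (of_nat k + of_nat N)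
       + (-1) ^ ((k - 1) div N) *
           ((of_nat N * euler_mascheroni - ln x) * zeta ((of_nat N + of_nat k - 1) / of_nat N)
            - deriv zeta ((of_nat N + of_nat k - 1) / of_nat N))
       - of_nat N * x powr ((1 - of_nat k) / of_nat N) *
           (of_nat N * deriv zeta (of_nat k) - (euler_mascheroni + ln x) * zeta (of_nat k))
       + of_nat N * (\<Sum>j = 1..(k - 1) div N - 1.
           (-1) ^ j * zeta (1 + of_nat j) * zeta (of_nat k - of_nat N * of_nat j) *
           x powr ((1 - of_nat k) / of_nat N + of_nat j))
     else if N dvd k then
       of_nat N / 2 * x powr ((1 - of_nat k - of_nat N) / of_nat N) * zeta (of_nat k + of_nat N)
       - of_real pi * zeta ((of_nat N + of_nat k - 1) / of_nat N)
           / sin (of_real pi / of_nat N * (of_nat k - 1))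
       - of_nat N * x powr ((1 - of_nat k) / of_nat N) *
           (of_nat N * deriv zeta (of_nat k) - (euler_mascheroni + ln x) * zeta (of_nat k))
       - of_nat N / 2 * (-1) ^ (k div N) * x powr (1 / of_nat N)
           * zeta ((of_nat k + of_nat N) / of_nat N)
       + of_nat N * (\<Sum>j = 1..(k - 1) div N.
           (-1) ^ j * zeta (1 + of_nat j) * zeta (of_nat k - of_nat N * of_nat j) *
           x powr ((1 - of_nat k) / of_nat N + of_nat j))
     else
       of_nat N / 2 * x powr ((1 - of_nat k - of_nat N) / of_nat N) * zeta (of_nat k + of_nat N)
       - of_real pi * zeta ((of_nat N + of_nat k - 1) / of_nat N)
           / sin (of_real pi / of_nat N * (of_nat k - 1))
       - of_nat N * x powr ((1 - of_nat k) / of_nat N) *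
           (of_nat N * deriv zeta (of_nat k) - (euler_mascheroni + ln x) * zeta (of_nat k))
       + of_nat N * (\<Sum>j = 1..(k - 1) div N.
           (-1) ^ j * zeta (1 + of_nat j) * zeta (of_nat k - of_nat N * of_nat j) *
           x powr ((1 - of_nat k) / of_nat N + of_nat j)))"

end

theory Submission
  imports Defs
begin

text \<open>
  Expanding \<open>\<psi>\<close> by \<open>\<psi>(z) + 1/z + \<gamma> = \<Sum>m\<ge>1. 1/m - 1/(m + z)\<close> turns every extended Herglotz function, up
  to explicit zeta values, into an absolutely convergent double series. With \<open>y = m (x/n)^(1/N)\<close>, the
  \<open>(m, n)\<close> term on the left is \<open>m^-k n^-1 y^N / (1 + y^N)\<close>, and the one with index \<open>j\<close> on the right is
  \<open>m^-k n^-1 z^(k-1) / (1 - z)\<close>, up to sign, where \<open>z\<close> runs through the \<open>N\<close>-th roots of \<open>- y^N\<close>.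
  The average over these roots is \<open>(- y^N)^c / (1 + y^N)\<close> with \<open>c\<close> the least integer \<open>\<ge> (k - 1) / N\<close>,
  so the two sides differ by the geometric sum of \<open>(- y^N)^i\<close> over \<open>0 < i < c\<close>. Its terms are
  products of a power of \<open>m\<close> and a power of \<open>n\<close>, whose double series are the products of zeta values
  in the residue. The zeta values split off at the start are weighted by the sums of \<open>\<rho>^(k-1)\<close>,
  \<open>j \<rho>^(k-1)\<close> and \<open>\<rho>^k\<close> over the \<open>N\<close>-th roots \<open>\<rho> = - exp (i \<pi> j / N)\<close> of \<open>-1\<close>, which depend on
  whether \<open>N\<close> divides \<open>k - 1\<close> or \<open>k\<close>.
\<close>

section \<open>The Dirichlet series of zeta and its derivative\<close>

lemma summable_Suc_powr:
  fixes p :: real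
  assumes "p > 1"
  shows "summable (\<lambda>n. 1 / real (Suc n) powr p)"
proof -
  have "summable (\<lambda>n. real n powr - p)"
    using assms by (simp add: summable_real_powr_iff)
  then have "summable (\<lambda>n. real (Suc n) powr - p)"
    by (subst summable_Suc_iff)
  then show ?thesis by (simp add: powr_minus divide_inverse)
qed

lemma norm_zeta_summand:
  "norm (1 / (of_nat (Suc n) :: complex) powr s) = 1 / real (Suc n) powr Re s"
  by (simp add: norm_divide norm_powr_real_powr del: of_nat_Suc)

lemma of_nat_Suc_powr_of_real:
  "(of_nat (Suc n) :: complex) powr of_real p = of_real (real (Suc n) powr p)"
  using powr_of_real[of "real (Suc n)" p] by simp

lemma summable_norm_zeta_summand:
  assumes "Re s > 1"
  shows "summable (\<lambda>n. norm (1 / (of_nat (Suc n) :: complex) powr s))"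
  unfolding norm_zeta_summand using assms by (rule summable_Suc_powr)

lemma zeta_sums:
  assumes "Re s > 1"
  shows "(\<lambda>n. 1 / of_nat (Suc n) powr s) sums zeta s"
  unfolding zeta_def
  by (rule summable_sums[OF summable_norm_cancel[OF summable_norm_zeta_summand[OF assms]]])

lemma zeta_of_nat_has_sum:
  assumes "a > 1"
  shows "((\<lambda>n. 1 / of_nat (Suc n) ^ a) has_sum zeta (of_nat a)) UNIV"
    and "(\<lambda>n. norm (1 / (of_nat (Suc n) :: complex) ^ a)) summable_on UNIV"
proof -
  have powr_eq_power: "(of_nat (Suc n) :: complex) powr of_nat a = of_nat (Suc n) ^ a" for n
    by (rule powr_nat') (simp del: of_nat_Suc)
  have summable: "summable (\<lambda>n. norm (1 / (of_nat (Suc n) :: complex) ^ a))"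
    using summable_norm_zeta_summand[of "of_nat a"] assms by (simp only: powr_eq_power) simp
  moreover have "(\<lambda>n. 1 / of_nat (Suc n) ^ a) sums zeta (of_nat a)"
    using zeta_sums[of "of_nat a"] assms by (simp only: powr_eq_power) simp
  ultimately show "((\<lambda>n. 1 / of_nat (Suc n) ^ a) has_sum zeta (of_nat a)) UNIV"
    by (rule norm_summable_imp_has_sum)
  show "(\<lambda>n. norm (1 / (of_nat (Suc n) :: complex) ^ a)) summable_on UNIV"
    using summable by (intro norm_summable_imp_summable_on) simp
qed

lemma zeta_summand_locally_dominated:
  assumes "Re s > 1"
  obtains d h where "d > 0" "summable h"
    "\<And>n t. t \<in> ball s d \<Longrightarrow> norm (1 / (of_nat (Suc n) :: complex) powr t) \<le> h n"
proof
  define d where "d = (Re s - 1) / 2"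
  show "d > 0" using assms by (simp add: d_def)
  then show "summable (\<lambda>n. 1 / real (Suc n) powr (1 + d))"
    by (intro summable_Suc_powr) simp
  fix n and t :: complex
  assume "t \<in> ball s d"
  then have "Re s - Re t < d"
    using complex_Re_le_cmod[of "s - t"] by (simp add: dist_norm)
  then have "1 + d \<le> Re t" by (simp add: d_def field_simps)
  then have "real (Suc n) powr (1 + d) \<le> real (Suc n) powr Re t"
    by (intro powr_mono) auto
  then show "norm (1 / (of_nat (Suc n) :: complex) powr t) \<le> 1 / real (Suc n) powr (1 + d)"
    unfolding norm_zeta_summand by (simp add: frac_le del: of_nat_Suc)
qed

lemma deriv_zeta_sums:
  assumes "Re s > 1"
  shows "(\<lambda>n. - of_real (ln (real (Suc n))) / of_nat (Suc n) powr s) sums deriv zeta s"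
proof -
  let ?f = "\<lambda>n s. 1 / (of_nat (Suc n) :: complex) powr s"
  let ?f' = "\<lambda>n s. - of_real (ln (real (Suc n))) / (of_nat (Suc n) :: complex) powr s"
  let ?S = "{s. Re s > 1}"
  have open_S: "open ?S" by (rule open_halfspace_Re_gt)
  have "\<exists>g g'. \<forall>s\<in>?S. (\<lambda>n. ?f n s) sums g s \<and> (\<lambda>n. ?f' n s) sums g' s \<and>
          (g has_field_derivative g' s) (at s)"
  proof (rule series_and_derivative_comparison_local[OF open_S])
    fix n s
    have "Ln (of_nat (Suc n)) = of_real (ln (real (Suc n)))"
      by (rule Ln_of_nat) simp
    then show "(?f n has_field_derivative ?f' n s) (at s)"
      by (auto intro!: derivative_eq_intros simp del: of_nat_Suc)
  next
    fix s assume "s \<in> ?S"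
    then obtain d h where "d > 0" "summable h" "\<And>n t. t \<in> ball s d \<Longrightarrow> norm (?f n t) \<le> h n"
      using zeta_summand_locally_dominated by auto
    then show "\<exists>d h. 0 < d \<and> summable h \<and>
        (\<forall>\<^sub>F n in sequentially. \<forall>t\<in>ball s d \<inter> ?S. norm (?f n t) \<le> h n)"
      by (intro exI[of _ d] exI[of _ h]) auto
  qed
  then obtain g g' where g: "\<And>s. Re s > 1 \<Longrightarrow> (\<lambda>n. ?f n s) sums g s"
      and g': "\<And>s. Re s > 1 \<Longrightarrow> (\<lambda>n. ?f' n s) sums g' s"
      and deriv_g: "\<And>s. Re s > 1 \<Longrightarrow> (g has_field_derivative g' s) (at s)" by fast
  have "g t = zeta t" if "Re t > 1" for t
    using g[OF that] zeta_sums[OF that] by (rule sums_unique2)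
  then have "(zeta has_field_derivative g' s) (at s)"
    using assms
    by (intro has_field_derivative_transform_within_open[OF deriv_g[OF assms] open_S]) auto
  then show ?thesis
    using g'[OF assms] by (simp add: DERIV_imp_deriv)
qed

section \<open>Expansion into a double series\<close>

lemma norm_nonneg_combination_ge:
  fixes u :: complex
  assumes "u \<notin> \<real>\<^sub>\<le>\<^sub>0"
  obtains c where "c > 0"
    "\<And>s t. s \<ge> 0 \<Longrightarrow> t \<ge> 0 \<Longrightarrow> c * (s + t * norm u) \<le> norm (of_real s + of_real t * u)"
proof
  define w where "w = csqrt u"
    \<comment> \<open>\<open>cnj w\<close> and \<open>cnj w * u\<close>, a positive multiple of \<open>w\<close>, both lie in the right half-plane\<close>
  have w: "w\<^sup>2 = u" "Re w > 0"
  proof -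
    show "w\<^sup>2 = u" by (simp add: w_def)
    moreover have "Re w \<noteq> 0"
    proof
      assume "Re w = 0"
      then have "u = of_real (- ((Im w)\<^sup>2))"
        using \<open>w\<^sup>2 = u\<close> by (auto simp: complex_eq_iff power2_eq_square)
      then show False
        using assms by (metis nonpos_Reals_of_real_iff neg_le_0_iff_le zero_le_power2)
    qed
    ultimately show "Re w > 0"
      using Re_csqrt[of u] by (simp add: w_def)
  qed
  then have norm_w: "norm w > 0" by auto
  show "Re w / norm w > 0" using w norm_w by simp
  fix s t :: real assume "s \<ge> 0" "t \<ge> 0"
  have "cnj w * (of_real s + of_real t * u) = of_real s * cnj w + of_real t * (w * cnj w) * w"
    unfolding w(1)[symmetric] by (simp add: power2_eq_square algebra_simps)
  also have "\<dots> = of_real s * cnj w + of_real (t * norm u) * w"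
    unfolding complex_norm_square[symmetric] by (simp add: norm_power flip: w(1))
  finally have "Re w * (s + t * norm u) = Re (cnj w * (of_real s + of_real t * u))"
    by (simp only:) (simp add: algebra_simps)
  also have "\<dots> \<le> norm w * norm (of_real s + of_real t * u)"
    using complex_Re_le_cmod[of "cnj w * (of_real s + of_real t * u)"] by (simp add: norm_mult)
  finally show "Re w / norm w * (s + t * norm u) \<le> norm (of_real s + of_real t * u)"
    using norm_w by (simp add: field_simps)
qed

lemma divide_add_le_powr:
  fixes a r :: real
  assumes "a > 0" "r > 0" "0 < \<alpha>" "\<alpha> < 1"
  shows "r / (a + r) \<le> (r / a) powr \<alpha>"
proof (cases "r \<le> a")
  case True
  have "r / (a + r) \<le> (r / a) powr 1" using assms by (simp add: frac_le)
  also have "\<dots> \<le> (r / a) powr \<alpha>" using True assms by (intro powr_mono') auto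
  finally show ?thesis .
next
  case False
  then have "1 \<le> (r / a) powr \<alpha>" using assms by (intro ge_one_powr_ge_zero) auto
  moreover have "r / (a + r) \<le> 1" using assms by simp
  ultimately show ?thesis by linarith
qed

lemma norm_reciprocal_diff_le:
  fixes u :: complex
  assumes "u \<notin> \<real>\<^sub>\<le>\<^sub>0"
  obtains C where "\<And>a t \<alpha>. a > 0 \<Longrightarrow> t > 0 \<Longrightarrow> 0 < \<alpha> \<Longrightarrow> \<alpha> < 1 \<Longrightarrow>
    norm (1 / of_real a - 1 / (of_real a + of_real t * u)) \<le> C / a * (t * norm u / a) powr \<alpha>"
proof -
  obtain c where c: "c > 0"
    "\<And>s t. s \<ge> 0 \<Longrightarrow> t \<ge> 0 \<Longrightarrow> c * (s + t * norm u) \<le> norm (of_real s + of_real t * u)"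
    using norm_nonneg_combination_ge[OF assms] by blast
  have "norm (1 / of_real a - 1 / (of_real a + of_real t * u)) \<le> (1 / c) / a * (t * norm u / a) powr \<alpha>"
    if "a > 0" "t > 0" "0 < \<alpha>" "\<alpha> < 1" for a t \<alpha>
  proof -
    define r where "r = t * norm u"
    have "u \<noteq> 0" using assms by auto
    then have r: "r > 0" using that by (simp add: r_def)
    have lower: "c * (a + r) \<le> norm (of_real a + of_real t * u)"
      using c(2)[of a t] that by (simp add: r_def)
    have pos: "0 < c * (a + r)" using c(1) r that by simp
    then have nonzero: "of_real a + of_real t * u \<noteq> 0" using lower by auto
    then have "1 / of_real a - 1 / (of_real a + of_real t * u) =
        of_real t * u / (of_real a * (of_real a + of_real t * u))"
      using that by (simp add: field_simps)
    then have "norm (1 / of_real a - 1 / (of_real a + of_real t * u)) =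
        r / (a * norm (of_real a + of_real t * u))"
      using that by (simp add: norm_mult norm_divide r_def)
    also have "\<dots> \<le> r / (a * (c * (a + r)))"
      using lower pos c(1) that r nonzero by (intro divide_left_mono mult_left_mono mult_pos_pos) auto
    also have "\<dots> = (1 / c) / a * (r / (a + r))" by simp
    also have "\<dots> \<le> (1 / c) / a * (r / a) powr \<alpha>"
      using divide_add_le_powr[of a r \<alpha>] r c(1) that by (intro mult_left_mono) auto
    finally show ?thesis by (simp only: r_def)
  qed
  then show thesis by (rule that)
qed

lemma has_sum_sum:
  fixes f :: "'i \<Rightarrow> 'a \<Rightarrow> 'b :: topological_comm_monoid_add"
  assumes "\<And>i. i \<in> I \<Longrightarrow> (f i has_sum s i) A"
  shows "((\<lambda>a. \<Sum>i\<in>I. f i a) has_sum (\<Sum>i\<in>I. s i)) A"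
  using assms by (induction I rule: infinite_finite_induct) (auto intro!: has_sum_add)

lemma has_sum_product:
  fixes f :: "'a \<Rightarrow> 'c :: {real_normed_field, banach}"
  assumes "(f has_sum S) A" "(\<lambda>x. norm (f x)) summable_on A"
    and "(g has_sum T) B" "(\<lambda>y. norm (g y)) summable_on B"
  shows "((\<lambda>(x, y). f x * g y) has_sum S * T) (A \<times> B)"
proof (rule has_sum_SigmaI)
  show "((\<lambda>y. case (x, y) of (x, y) \<Rightarrow> f x * g y) has_sum f x * T) B" for x
    unfolding prod.case by (intro has_sum_cmult_right assms)
  show "((\<lambda>x. f x * T) has_sum S * T) A"
    by (intro has_sum_cmult_left assms)
  have "(\<lambda>x. norm (f x) * (\<Sum>\<^sub>\<infinity>y\<in>B. norm (g y))) summable_on A"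
    using assms by (intro summable_on_cmult_left)
  then have "(\<lambda>z. norm (case z of (x, y) \<Rightarrow> f x * g y)) summable_on A \<times> B"
    using assms(4)
    by (subst Infinite_Sum.abs_summable_on_Sigma_iff)
      (simp add: norm_mult infsum_cmult_right' abs_mult infsum_nonneg summable_on_cmult_right)
  then show "(\<lambda>(x, y). f x * g y) summable_on A \<times> B"
    by (rule Infinite_Sum.abs_summable_summable)
qed

definition digamma_summand :: "real \<Rightarrow> real \<Rightarrow> complex \<Rightarrow> nat \<times> nat \<Rightarrow> complex" where
  "digamma_summand p b u = (\<lambda>(n, m). 1 / of_real (real (Suc n) powr p) *
     (1 / of_nat (Suc m) - 1 / (of_nat (Suc m) + of_real (real (Suc n) powr b) * u)))"

definition digamma_double_series :: "real \<Rightarrow> real \<Rightarrow> complex \<Rightarrow> complex" where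
  "digamma_double_series p b u = infsum (digamma_summand p b u) (UNIV \<times> UNIV)"

lemma norm_digamma_summand_le:
  assumes "u \<notin> \<real>\<^sub>\<le>\<^sub>0"
  obtains C where "\<And>p b \<alpha> n m. 0 < \<alpha> \<Longrightarrow> \<alpha> < 1 \<Longrightarrow> norm (digamma_summand p b u (n, m)) \<le>
    C * norm u powr \<alpha> * (1 / real (Suc n) powr (p - b * \<alpha>) * (1 / real (Suc m) powr (1 + \<alpha>)))"
proof -
  obtain C where C: "\<And>a t \<alpha>. a > 0 \<Longrightarrow> t > 0 \<Longrightarrow> 0 < \<alpha> \<Longrightarrow> \<alpha> < 1 \<Longrightarrow>
      norm (1 / of_real a - 1 / (of_real a + of_real t * u)) \<le> C / a * (t * norm u / a) powr \<alpha>"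
    using norm_reciprocal_diff_le[OF assms] by blast
  show thesis
  proof
    fix p b \<alpha> :: real and n m assume \<alpha>: "0 < \<alpha>" "\<alpha> < 1"
    define M t where "M = real (Suc m)" and "t = real (Suc n) powr b"
    have pos: "M > 0" "t > 0" by (auto simp: M_def t_def)
    have "norm (digamma_summand p b u (n, m)) =
        1 / real (Suc n) powr p * norm (1 / of_real M - 1 / (of_real M + of_real t * u))"
      by (simp add: digamma_summand_def norm_mult norm_divide M_def t_def del: of_nat_Suc)
    also have "\<dots> \<le> 1 / real (Suc n) powr p * (C / M * (t * norm u / M) powr \<alpha>)"
      using C[OF pos \<alpha>] by (intro mult_left_mono) auto
    also have "(t * norm u / M) powr \<alpha> = real (Suc n) powr (b * \<alpha>) * norm u powr \<alpha> / M powr \<alpha>"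
      using pos by (simp add: powr_divide powr_mult t_def powr_powr)
    also have "1 / real (Suc n) powr p *
        (C / M * (real (Suc n) powr (b * \<alpha>) * norm u powr \<alpha> / M powr \<alpha>)) =
        C * norm u powr \<alpha> * (1 / real (Suc n) powr (p - b * \<alpha>) * (1 / M powr (1 + \<alpha>)))"
      using pos by (simp add: powr_diff powr_add)
    finally show "norm (digamma_summand p b u (n, m)) \<le>
        C * norm u powr \<alpha> * (1 / real (Suc n) powr (p - b * \<alpha>) * (1 / real (Suc m) powr (1 + \<alpha>)))"
      by (simp only: M_def)
  qed
qed

lemma digamma_summand_has_sum:
  assumes "p > 1" "b > 0" "u \<notin> \<real>\<^sub>\<le>\<^sub>0"
  shows "(digamma_summand p b u has_sum digamma_double_series p b u) (UNIV \<times> UNIV)"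
proof -
  define \<alpha> where "\<alpha> = min (1 / 2) ((p - 1) / (2 * b))"
  have \<alpha>: "0 < \<alpha>" "\<alpha> < 1" using assms by (auto simp: \<alpha>_def)
  have "b * \<alpha> \<le> b * ((p - 1) / (2 * b))"
    using assms by (intro mult_left_mono) (auto simp: \<alpha>_def)
  also have "\<dots> = (p - 1) / 2" using assms by simp
  finally have exponent: "p - b * \<alpha> > 1" using assms by simp
  have summable: "(\<lambda>n. 1 / real (Suc n) powr s) summable_on UNIV" if "s > 1" for s
    using summable_Suc_powr[OF that] by (subst summable_on_UNIV_nonneg_real_iff) auto
  obtain C where C: "\<And>n m. norm (digamma_summand p b u (n, m)) \<le>
      C * norm u powr \<alpha> * (1 / real (Suc n) powr (p - b * \<alpha>) * (1 / real (Suc m) powr (1 + \<alpha>)))"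
    using norm_digamma_summand_le[OF assms(3)] \<alpha> by metis
  have "(\<lambda>(n, m). 1 / real (Suc n) powr (p - b * \<alpha>) * (1 / real (Suc m) powr (1 + \<alpha>)))
      summable_on UNIV \<times> UNIV"
    by (rule has_sum_imp_summable[OF has_sum_product[OF has_sum_infsum _ has_sum_infsum]])
      (use summable exponent \<alpha> in simp_all)
  then have "(\<lambda>z. C * norm u powr \<alpha> * (case z of (n, m) \<Rightarrow>
      1 / real (Suc n) powr (p - b * \<alpha>) * (1 / real (Suc m) powr (1 + \<alpha>)))) summable_on UNIV \<times> UNIV"
    by (rule summable_on_cmult_right)
  then have "(\<lambda>z. norm (digamma_summand p b u z)) summable_on UNIV \<times> UNIV"
    by (rule Infinite_Sum.abs_summable_on_comparison_test') (use C in auto)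
  then show ?thesis
    unfolding digamma_double_series_def
    by (intro has_sum_infsum) (rule Infinite_Sum.abs_summable_summable)
qed

lemma Digamma_sums:
  fixes z :: complex
  assumes "z \<notin> \<real>\<^sub>\<le>\<^sub>0"
  shows "(\<lambda>m. 1 / of_nat (Suc m) - 1 / (of_nat (Suc m) + z)) sums
    (Digamma z + 1 / z + euler_mascheroni)"
proof -
  have "z + 1 \<noteq> 0"
    using assms by (auto simp: add_eq_0_iff2)
  then have "(\<lambda>m. inverse (of_nat (Suc m)) - inverse (z + 1 + of_nat m)) sums
      (Digamma (z + 1) + euler_mascheroni)"
    using summable_sums[OF summable_Digamma] by (simp add: Digamma_def)
  moreover have "Digamma (z + 1) = Digamma z + 1 / z"
    using assms by (intro Digamma_plus1) auto
  ultimately show ?thesis by (simp add: inverse_eq_divide add_ac)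
qed

lemma digamma_rows_sums:
  assumes "p > 1" "b > 0" "u \<notin> \<real>\<^sub>\<le>\<^sub>0"
  defines "z \<equiv> \<lambda>n. of_real (real (Suc n) powr b) * u"
  shows "(\<lambda>n. 1 / of_real (real (Suc n) powr p) * (Digamma (z n) + 1 / z n + euler_mascheroni)) sums
    digamma_double_series p b u"
proof (rule has_sum_imp_sums, rule has_sum_SigmaD)
  show has_sum: "(digamma_summand p b u has_sum digamma_double_series p b u) (UNIV \<times> UNIV)"
    by (rule digamma_summand_has_sum[OF assms(1-3)])
  fix n
  have "z n \<notin> \<real>\<^sub>\<le>\<^sub>0"
    using assms(3) by (auto simp: z_def complex_nonpos_Reals_iff mult_le_0_iff)
  then have "(\<lambda>m. digamma_summand p b u (n, m)) sums
      (1 / of_real (real (Suc n) powr p) * (Digamma (z n) + 1 / z n + euler_mascheroni))"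
    unfolding digamma_summand_def prod.case z_def by (intro sums_mult Digamma_sums)
  moreover have "(\<lambda>m. digamma_summand p b u (n, m)) summable_on UNIV"
    using summable_on_SigmaD1[of "\<lambda>n m. digamma_summand p b u (n, m)" UNIV "\<lambda>_. UNIV" n]
      has_sum_imp_summable[OF has_sum] by simp
  ultimately show "((\<lambda>m. digamma_summand p b u (n, m)) has_sum
      (1 / of_real (real (Suc n) powr p) * (Digamma (z n) + 1 / z n + euler_mascheroni))) UNIV"
    by (metis has_sum_imp_sums has_sum_infsum sums_unique2)
qed

definition herglotz_correction :: "real \<Rightarrow> real \<Rightarrow> complex \<Rightarrow> complex" where
  "herglotz_correction p b u = of_real b * deriv zeta (of_real p)
     - (euler_mascheroni + ln u) * zeta (of_real p) - zeta (of_real (p + b)) / (2 * u)"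

lemma herglotz_correction_sums:
  assumes "p > 1" "b > 0" "u \<noteq> 0"
  defines "z \<equiv> \<lambda>n. of_real (real (Suc n) powr b) * u"
  shows "(\<lambda>n. - 1 / of_real (real (Suc n) powr p) * (euler_mascheroni + ln (z n) + 1 / (2 * z n))) sums
    herglotz_correction p b u"
proof -
  have summand: "of_real b * (- of_real (ln (real (Suc n))) / of_nat (Suc n) powr of_real p)
      - (euler_mascheroni + ln u) * (1 / of_nat (Suc n) powr of_real p)
      - 1 / of_nat (Suc n) powr of_real (p + b) / (2 * u) =
      - 1 / of_real (real (Suc n) powr p) * (euler_mascheroni + ln (z n) + 1 / (2 * z n))" for n
  proof -
    have "ln (z n) = of_real (b * ln (real (Suc n))) + ln u"
      unfolding z_def using assms(3)
      by (subst Ln_times_of_real) (simp_all add: Ln_of_real ln_powr del: of_nat_Suc)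
    then show ?thesis
      unfolding of_nat_Suc_powr_of_real
      using assms(3) by (simp add: z_def powr_add field_simps del: of_nat_Suc)
  qed
  show ?thesis
    unfolding herglotz_correction_def summand[symmetric]
    by (intro sums_diff sums_mult sums_divide zeta_sums deriv_zeta_sums) (use assms in auto)
qed

lemma herglotz_eq_double_series:
  assumes "p > 1" "b > 0" "u \<notin> \<real>\<^sub>\<le>\<^sub>0"
  shows "herglotz p b u = digamma_double_series p b u + herglotz_correction p b u"
proof -
  define z where "z = (\<lambda>n. of_real (real (Suc n) powr b) * u)"
  have "u \<noteq> 0" using assms(3) by auto
  have "z n \<noteq> 0" for n using \<open>u \<noteq> 0\<close> by (simp add: z_def)
  then have "1 / of_real (real (Suc n) powr p) * (Digamma (z n) + 1 / z n + euler_mascheroni)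
      + - 1 / of_real (real (Suc n) powr p) * (euler_mascheroni + ln (z n) + 1 / (2 * z n)) =
      1 / of_real (real (Suc n) powr p) * (Digamma (z n) - ln (z n) + 1 / (2 * z n))" for n
    by (simp add: field_simps)
  moreover have "(\<lambda>n. 1 / of_real (real (Suc n) powr p) * (Digamma (z n) + 1 / z n + euler_mascheroni)
      + - 1 / of_real (real (Suc n) powr p) * (euler_mascheroni + ln (z n) + 1 / (2 * z n))) sums
      (digamma_double_series p b u + herglotz_correction p b u)"
    unfolding z_def
    by (intro sums_add digamma_rows_sums herglotz_correction_sums assms \<open>u \<noteq> 0\<close>)
  ultimately show ?thesis
    unfolding herglotz_def z_def by (simp add: sums_iff mult.assoc)
qed

section \<open>Power sums over the roots of minus one\<close>

definition balanced_indices :: "nat \<Rightarrow> int set" where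
  "balanced_indices N = {j. j \<in> {- (int N - 1)..int N - 1} \<and> [j = int N - 1] (mod 2)}"

lemma balanced_indicesD:
  assumes "j \<in> balanced_indices N"
  shows "- (int N - 1) \<le> j" "j \<le> int N - 1" "even j \<longleftrightarrow> odd N"
  using assms by (auto simp: balanced_indices_def cong_iff_dvd_diff)

lemma balanced_indices_eq_image:
  "balanced_indices N = (\<lambda>l. 2 * int l - (int N - 1)) ` {..<N}"
proof (intro equalityI subsetI)
  fix j assume "j \<in> balanced_indices N"
  then have j: "- (int N - 1) \<le> j" "j \<le> int N - 1" "even (j - (int N - 1))"
    by (auto simp: balanced_indices_def cong_iff_dvd_diff)
  from j(3) obtain i where "j - (int N - 1) = 2 * i" by (rule evenE)
  with j have "j = 2 * int (nat (int N - 1 + i)) - (int N - 1)" "nat (int N - 1 + i) < N" by auto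
  then show "j \<in> (\<lambda>l. 2 * int l - (int N - 1)) ` {..<N}" by blast
next
  fix j assume "j \<in> (\<lambda>l. 2 * int l - (int N - 1)) ` {..<N}"
  then show "j \<in> balanced_indices N" by (auto simp: balanced_indices_def cong_iff_dvd_diff)
qed

lemma card_balanced_indices: "card (balanced_indices N) = N"
  by (simp add: balanced_indices_eq_image card_image inj_on_def)

lemma sum_balanced_indices_Suc:
  "sum f (balanced_indices (Suc N)) = f (int N) + (\<Sum>j\<in>balanced_indices N. f (j - 1))"
  by (simp add: balanced_indices_eq_image sum.reindex inj_on_def algebra_simps)

lemma sum_of_int_balanced_indices: "(\<Sum>j\<in>balanced_indices N. of_int j) = (0 :: complex)"
proof -
  have "(\<Sum>j\<in>balanced_indices N. of_int j) = (\<Sum>j\<in>balanced_indices N. - of_int j :: complex)"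
    by (rule sum.reindex_bij_witness[of _ uminus uminus])
      (auto simp: balanced_indices_def cong_iff_dvd_diff)
  then show ?thesis by (simp add: sum_negf)
qed

lemma sum_powi_balanced_indices:
  fixes w :: "'a :: field"
  assumes "w \<noteq> 0"
  shows "(w - 1 / w) * (\<Sum>j\<in>balanced_indices N. w powi j) = w ^ N - 1 / w ^ N"
proof (induction N)
  case 0
  then show ?case by (simp add: balanced_indices_eq_image)
next
  case (Suc N)
  have "(\<Sum>j\<in>balanced_indices (Suc N). w powi j) = w ^ N + (\<Sum>j\<in>balanced_indices N. w powi j) / w"
    using assms by (simp add: sum_balanced_indices_Suc power_int_diff sum_divide_distrib)
  then have "(w - 1 / w) * (\<Sum>j\<in>balanced_indices (Suc N). w powi j) =
      (w - 1 / w) * w ^ N + (w ^ N - 1 / w ^ N) / w"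
    by (simp add: distrib_left flip: Suc.IH)
  then show ?case using assms by (simp add: field_simps)
qed

text \<open>The derivative \<open>w d/dw\<close> of the preceding identity.\<close>

lemma sum_of_int_powi_balanced_indices:
  fixes w :: "'a :: field"
  assumes "w \<noteq> 0"
  shows "(w - 1 / w) * (\<Sum>j\<in>balanced_indices N. of_int j * w powi j) =
    of_nat N * (w ^ N + 1 / w ^ N) - (w + 1 / w) * (\<Sum>j\<in>balanced_indices N. w powi j)"
proof (induction N)
  case 0
  then show ?case by (simp add: balanced_indices_eq_image)
next
  case (Suc N)
  define S where "S = (\<Sum>j\<in>balanced_indices N. w powi j)"
  define T where "T = (\<Sum>j\<in>balanced_indices N. of_int j * w powi j)"
  have sum_Suc: "(\<Sum>j\<in>balanced_indices (Suc N). w powi j) = w ^ N + S / w"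
    using assms by (simp add: S_def sum_balanced_indices_Suc power_int_diff sum_divide_distrib)
  have "(\<Sum>j\<in>balanced_indices (Suc N). of_int j * w powi j) = of_nat N * w ^ N + (T - S) / w"
    using assms
    by (simp add: S_def T_def sum_balanced_indices_Suc power_int_diff sum_divide_distrib
        left_diff_distrib diff_divide_distrib sum_subtractf)
  moreover have "(w - 1 / w) * (of_nat N * w ^ N + (T - S) / w) =
      of_nat N * ((w - 1 / w) * w ^ N) + ((w - 1 / w) * T - (w - 1 / w) * S) / w"
    using assms by (simp add: field_simps)
  moreover have "(w - 1 / w) * S = w ^ N - 1 / w ^ N"
    unfolding S_def by (rule sum_powi_balanced_indices[OF assms])
  moreover have "(w - 1 / w) * T = of_nat N * (w ^ N + 1 / w ^ N) - (w + 1 / w) * S"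
    unfolding S_def T_def by (rule Suc.IH)
  moreover have "of_nat N * ((w - 1 / w) * w ^ N)
      + (of_nat N * (w ^ N + 1 / w ^ N) - (w + 1 / w) * S - (w - 1 / w) * S) / w =
      of_nat (Suc N) * (w ^ Suc N + 1 / w ^ Suc N) - (w + 1 / w) * (w ^ N + S / w)
        - ((w - 1 / w) * S - (w ^ N - 1 / w ^ N)) / w"
    using assms by (simp add: field_simps)
  ultimately show ?case
    unfolding sum_Suc by simp
qed

text \<open>For \<open>j \<in> balanced_indices N\<close> these are the \<open>N\<close>-th roots of \<open>-1\<close>, each taken once.\<close>

definition minus_one_root :: "nat \<Rightarrow> int \<Rightarrow> complex" where
  "minus_one_root N j = - cis (pi * of_int j / of_nat N)"

lemma minus_one_root_nonzero: "minus_one_root N j \<noteq> 0"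
  by (simp add: minus_one_root_def)

lemma minus_one_root_power:
  "minus_one_root N j ^ h = (-1) ^ h * cis (pi * of_nat h / of_nat N) powi j"
  unfolding minus_one_root_def power_minus[of "cis _"] cis_power_int Complex.DeMoivre
  by (simp add: mult_ac)

lemma minus_one_root_power_eq_exp:
  assumes "k > 0"
  shows "minus_one_root N j ^ (k - 1) =
    - ((-1) ^ k * exp (\<i> * of_real pi * of_int j * (of_nat k - 1) / of_nat N))"
proof -
  obtain h where "k = Suc h" using assms gr0_conv_Suc by blast
  then show ?thesis
    unfolding minus_one_root_power cis_power_int unfolding cis_conv_exp by (simp add: mult_ac)
qed

lemma minus_one_root_power_self:
  assumes "j \<in> balanced_indices N"
  shows "minus_one_root N j ^ N = -1"
proof -
  have "N > 0" using balanced_indicesD(1,2)[OF assms] by linarith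
  then have "minus_one_root N j ^ N = (-1) ^ N * (-1) powi j"
    by (simp add: minus_one_root_power)
  then show ?thesis
    using balanced_indicesD(3)[OF assms] by (simp add: power_int_minus_left)
qed

lemma minus_one_root_power_multiple:
  assumes "j \<in> balanced_indices N" "N dvd h"
  shows "minus_one_root N j ^ h = (-1) ^ (h div N)"
proof -
  obtain c where "h = N * c" using assms(2) by blast
  moreover have "N > 0" using balanced_indicesD(1,2)[OF assms(1)] by linarith
  ultimately show ?thesis
    using assms(1) by (simp add: power_mult minus_one_root_power_self)
qed

lemma sin_pi_fraction_eq_0_iff:
  assumes "N > 0"
  shows "sin (pi * real h / real N) = 0 \<longleftrightarrow> N dvd h"
proof -
  have "sin (pi * real h / real N) = 0 \<longleftrightarrow> (\<exists>i::int. real h / real N = of_int i)"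
    unfolding sin_zero_iff_int2 by (simp add: mult_ac flip: times_divide_eq_right)
  also have "\<dots> \<longleftrightarrow> (\<exists>i::int. real_of_int (int h) = real_of_int (int N * i))"
    using assms by (simp add: field_simps)
  also have "\<dots> \<longleftrightarrow> N dvd h"
    unfolding of_int_eq_iff by (metis dvd_def int_dvd_int_iff)
  finally show ?thesis .
qed

lemma
  fixes N h :: nat
  defines "w \<equiv> cis (pi * of_nat h / of_nat N)"
  shows cis_pi_fraction_power_self: "N > 0 \<Longrightarrow> w ^ N = (-1) ^ h"
    and cis_pi_fraction_diff_inverse: "w - 1 / w = 2 * \<i> * of_real (sin (pi * of_nat h / of_nat N))"
proof -
  show "w ^ N = (-1) ^ h" if "N > 0"
    using that Complex.DeMoivre[of pi h] by (simp add: w_def Complex.DeMoivre mult_ac)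
  have "1 / w = cis (- (pi * of_nat h / of_nat N))"
    by (simp add: w_def inverse_eq_divide flip: cis_inverse)
  then show "w - 1 / w = 2 * \<i> * of_real (sin (pi * of_nat h / of_nat N))"
    by (simp add: w_def complex_eq_iff)
qed

lemma
  assumes "N > 0" "\<not> N dvd h"
  defines "w \<equiv> cis (pi * of_nat h / of_nat N)"
  shows sum_powi_cis_pi_fraction: "(\<Sum>j\<in>balanced_indices N. w powi j) = 0"
    and sum_of_int_powi_cis_pi_fraction: "(\<Sum>j\<in>balanced_indices N. of_int j * w powi j) =
      of_nat N * (-1) ^ h / (\<i> * of_real (sin (pi * of_nat h / of_nat N)))"
proof -
  have w: "w \<noteq> 0" "w ^ N = (-1) ^ h" "w - 1 / w = 2 * \<i> * of_real (sin (pi * of_nat h / of_nat N))"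
    using assms(1) cis_pi_fraction_power_self cis_pi_fraction_diff_inverse by (auto simp: w_def)
  have sin: "sin (pi * real h / real N) \<noteq> 0" using assms sin_pi_fraction_eq_0_iff by simp
  have sign: "1 / (-1) ^ h = ((-1) ^ h :: complex)" by (simp add: minus_one_power_iff)
  show sum: "(\<Sum>j\<in>balanced_indices N. w powi j) = 0"
    using sum_powi_balanced_indices[OF w(1), of N] sin unfolding w(2,3) sign by simp
  show "(\<Sum>j\<in>balanced_indices N. of_int j * w powi j) =
      of_nat N * (-1) ^ h / (\<i> * of_real (sin (pi * of_nat h / of_nat N)))"
    using sum_of_int_powi_balanced_indices[OF w(1), of N] sin
    unfolding w(2,3) sign sum by (simp add: field_simps)
qed

lemma sum_minus_one_root_power:
  assumes "N > 0"
  shows "(\<Sum>j\<in>balanced_indices N. minus_one_root N j ^ h) =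
    (if N dvd h then of_nat N * (-1) ^ (h div N) else 0)"
proof (cases "N dvd h")
  case True
  then have "(\<Sum>j\<in>balanced_indices N. minus_one_root N j ^ h) =
      (\<Sum>j\<in>balanced_indices N. (-1) ^ (h div N))"
    by (intro sum.cong refl minus_one_root_power_multiple)
  then show ?thesis using True by (simp add: card_balanced_indices)
next
  case False
  then show ?thesis
    using sum_powi_cis_pi_fraction[OF assms False]
    by (simp add: minus_one_root_power flip: sum_distrib_left)
qed

lemma sum_of_int_minus_one_root_power:
  assumes "N > 0"
  shows "(\<Sum>j\<in>balanced_indices N. of_int j * minus_one_root N j ^ h) =
    (if N dvd h then 0 else of_nat N / (\<i> * of_real (sin (pi * of_nat h / of_nat N))))"
proof (cases "N dvd h")
  case True
  then have "(\<Sum>j\<in>balanced_indices N. of_int j * minus_one_root N j ^ h) =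
      (\<Sum>j\<in>balanced_indices N. of_int j) * (-1) ^ (h div N)"
    unfolding sum_distrib_right by (intro sum.cong refl) (simp add: minus_one_root_power_multiple)
  then show ?thesis using True by (simp add: sum_of_int_balanced_indices)
next
  case False
  have "(\<Sum>j\<in>balanced_indices N. of_int j * minus_one_root N j ^ h) =
      (-1) ^ h * (\<Sum>j\<in>balanced_indices N. of_int j * cis (pi * of_nat h / of_nat N) powi j)"
    unfolding sum_distrib_left by (intro sum.cong refl) (simp add: minus_one_root_power mult_ac)
  then show ?thesis
    using False sum_of_int_powi_cis_pi_fraction[OF assms False]
    by (simp flip: power_mult_distrib)
qed

lemma dvd_Suc_add_iff:
  fixes N h i :: nat
  assumes "i < N"
  shows "N dvd Suc h + i \<longleftrightarrow> i = N - 1 - h mod N"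
proof -
  define r where "r = h mod N"
  have r: "r < N" using assms by (simp add: r_def)
  have "Suc h + i = h div N * N + Suc (r + i)"
    using div_mult_mod_eq[of h N] by (simp add: r_def)
  then have "N dvd Suc h + i \<longleftrightarrow> N dvd Suc (r + i)"
    by (simp only: dvd_add_right_iff dvd_triv_right)
  also have "\<dots> \<longleftrightarrow> Suc (r + i) = N"
  proof
    assume "N dvd Suc (r + i)"
    then obtain c where c: "Suc (r + i) = N * c" by blast
    then have "N * c < N * 2" using assms r by linarith
    then have "c = 1" using c by (cases c) auto
    then show "Suc (r + i) = N" using c by simp
  qed simp
  also have "\<dots> \<longleftrightarrow> i = N - 1 - r"
    using assms r by auto
  finally show ?thesis by (simp only: r_def)
qed

lemma power_divide_one_minus:
  fixes z :: "'a :: field"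
  assumes "z ^ n \<noteq> 1"
  shows "z ^ m / (1 - z) = (\<Sum>i<n. z ^ (m + i)) / (1 - z ^ n)"
proof -
  have "1 - z ^ n \<noteq> 0" using assms by simp
  then show ?thesis
    unfolding one_diff_power_eq power_add sum_distrib_left[symmetric] by (simp add: frac_eq_eq)
qed

text \<open>
  As formal power series in \<open>y\<close>, averaging \<open>z ^ Suc h / (1 - z)\<close> over the roots \<open>z\<close> of \<open>z ^ N = - (y ^ N)\<close>
  keeps exactly the exponents divisible by \<open>N\<close>.
\<close>

lemma sum_scaled_minus_one_root_power_divide:
  assumes "N > 0" "y ^ N \<noteq> -1"
  shows "(\<Sum>j\<in>balanced_indices N. (y * minus_one_root N j) ^ Suc h / (1 - y * minus_one_root N j)) =
    of_nat N * (- (y ^ N)) ^ Suc (h div N) / (1 + y ^ N)"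
proof -
  have "(y * minus_one_root N j) ^ Suc h / (1 - y * minus_one_root N j) =
      (\<Sum>i<N. y ^ (Suc h + i) * minus_one_root N j ^ (Suc h + i)) / (1 + y ^ N)"
    if "j \<in> balanced_indices N" for j
  proof -
    have power_self: "(y * minus_one_root N j) ^ N = - (y ^ N)"
      using minus_one_root_power_self[OF that] by (simp add: power_mult_distrib)
    then have "(y * minus_one_root N j) ^ N \<noteq> 1"
      using assms(2) by (simp add: minus_equation_iff)
    from power_divide_one_minus[OF this, of "Suc h"] show ?thesis
      unfolding power_self by (simp only: power_mult_distrib diff_minus_eq_add)
  qed
  then have "(\<Sum>j\<in>balanced_indices N. (y * minus_one_root N j) ^ Suc h / (1 - y * minus_one_root N j)) =
      (\<Sum>j\<in>balanced_indices N. \<Sum>i<N. y ^ (Suc h + i) * minus_one_root N j ^ (Suc h + i)) / (1 + y ^ N)"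
    unfolding sum_divide_distrib[of _ "balanced_indices N"] by (intro sum.cong refl)
  also have "(\<Sum>j\<in>balanced_indices N. \<Sum>i<N. y ^ (Suc h + i) * minus_one_root N j ^ (Suc h + i)) =
      (\<Sum>i<N. y ^ (Suc h + i) * (\<Sum>j\<in>balanced_indices N. minus_one_root N j ^ (Suc h + i)))"
    unfolding sum_distrib_left by (rule sum.swap)
  also have "\<dots> = (\<Sum>i<N. if i = N - 1 - h mod N
      then y ^ (Suc h + i) * (of_nat N * (-1) ^ ((Suc h + i) div N)) else 0)"
    using assms(1)
    by (intro sum.cong refl) (simp add: sum_minus_one_root_power dvd_Suc_add_iff del: add_Suc)
  also have "\<dots> = of_nat N * (- (y ^ N)) ^ Suc (h div N)"
  proof -
    have index: "Suc h + (N - 1 - h mod N) = N * Suc (h div N)"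
      using mult_div_mod_eq[of N h] mod_less_divisor[OF assms(1), of h]
      unfolding mult_Suc_right by linarith
    have "(\<Sum>i<N. if i = N - 1 - h mod N
        then y ^ (Suc h + i) * (of_nat N * (-1) ^ ((Suc h + i) div N)) else 0) =
        y ^ (N * Suc (h div N)) * (of_nat N * (-1) ^ (N * Suc (h div N) div N))"
      using assms(1) by (simp only: sum.delta' sum.delta finite_lessThan index flip: index) simp
    then show ?thesis
      using assms(1) by (simp add: power_mult power_minus[of "y ^ N"] del: power_Suc mult_Suc_right)
  qed
  finally show ?thesis .
qed

lemma power_divide_one_plus_eq_root_sum:
  assumes "N > 0" "y ^ N \<noteq> -1"
  shows "y ^ N / (1 + y ^ N) =
    - (1 / of_nat N * (\<Sum>j\<in>balanced_indices N.
        (y * minus_one_root N j) ^ Suc h / (1 - y * minus_one_root N j)))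
    - (\<Sum>i=1..h div N. (- (y ^ N)) ^ i)"
proof -
  define a where "a = - (y ^ N)"
  have a: "a \<noteq> 1" using assms(2) by (auto simp: a_def minus_equation_iff)
  have "(\<Sum>i=1..h div N. a ^ i) = (a - a ^ Suc (h div N)) / (1 - a)"
    using a by (simp add: sum_gp)
  then have "- a / (1 - a) = - (a ^ Suc (h div N) / (1 - a)) - (\<Sum>i=1..h div N. a ^ i)"
    by (simp add: diff_divide_distrib)
  then show ?thesis
    unfolding sum_scaled_minus_one_root_power_divide[OF assms] a_def using assms(1) by simp
qed

section \<open>The dual parameters\<close>

definition dual_exponent :: "nat \<Rightarrow> nat \<Rightarrow> real" where
  "dual_exponent N k = (real N + real k - 1) / real N"

definition dual_argument :: "nat \<Rightarrow> complex \<Rightarrow> int \<Rightarrow> complex" where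
  "dual_argument N x j = - 1 / (minus_one_root N j * x powr (1 / of_nat N))"

lemma dual_exponent_gt_1:
  assumes "N > 0" "k > 1"
  shows "dual_exponent N k > 1"
  using assms by (simp add: dual_exponent_def field_simps)

lemma powr_dual_exponent:
  assumes "N > 0" "k > 0" "t > 0"
  shows "t powr dual_exponent N k = t * (t powr (1 / real N)) ^ (k - 1)"
proof -
  have "dual_exponent N k = 1 + real (k - 1) * (1 / real N)"
    using assms by (simp add: dual_exponent_def field_simps of_nat_diff)
  then show ?thesis
    using assms by (simp add: powr_add powr_power mult_ac)
qed

lemma
  fixes N k :: nat
  shows of_real_dual_exponent:
      "complex_of_real (dual_exponent N k) = (of_nat N + of_nat k - 1) / of_nat N"
    and of_real_dual_exponent_add:
      "complex_of_real (dual_exponent N k + 1 / real N) = (of_nat k + of_nat N) / of_nat N"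
  by (simp_all add: dual_exponent_def add_divide_distrib diff_divide_distrib)

lemma exp_divide_powr_eq_dual_argument:
  "exp (- (\<i> * of_real pi * of_int j / of_nat N)) / x powr (1 / of_nat N) = dual_argument N x j"
  by (simp add: dual_argument_def minus_one_root_def cis_conv_exp exp_minus divide_inverse mult_ac)

lemma powr_of_nat_divide:
  fixes x :: complex
  assumes "x \<noteq> 0"
  shows "x powr (of_nat m / of_nat N) = (x powr (1 / of_nat N)) ^ m"
  using assms by (simp add: powr_def flip: exp_of_nat_mult)

lemma powr_inverse_of_nat_power_self:
  fixes x :: complex
  assumes "x \<noteq> 0" "N > 0"
  shows "(x powr (1 / of_nat N)) ^ N = x"
  using assms powr_of_nat_divide[of x N N] by simp

lemma
  assumes "j \<in> balanced_indices N" "x \<notin> \<real>\<^sub>\<le>\<^sub>0"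
  shows Ln_dual_argument:
      "ln (dual_argument N x j) = - (\<i> * of_real pi * of_int j / of_nat N) - ln x / of_nat N"
    and dual_argument_not_nonpos: "dual_argument N x j \<notin> \<real>\<^sub>\<le>\<^sub>0"
proof -
  have N: "N > 0" and j: "\<bar>real_of_int j\<bar> \<le> real N - 1"
    using balanced_indicesD(1,2)[OF assms(1)] by linarith+
  have "x \<noteq> 0" using assms(2) by auto
  define w where "w = - (\<i> * of_real pi * of_int j / of_nat N) - ln x / of_nat N"
  have "cis (pi * of_int j / of_nat N) = exp (\<i> * of_real pi * of_int j / of_nat N)"
    by (simp add: cis_conv_exp mult_ac)
  then have exp_w: "dual_argument N x j = exp w"
    using \<open>x \<noteq> 0\<close>
    by (simp add: dual_argument_def minus_one_root_def w_def powr_def exp_diff exp_minus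
        divide_inverse mult_ac)
  have "Im (ln x) \<noteq> pi"
    using assms(2) Im_Ln_eq_pi[OF \<open>x \<noteq> 0\<close>] by (auto simp: complex_nonpos_Reals_iff)
  then have "\<bar>Im (ln x)\<bar> < pi"
    using mpi_less_Im_Ln[OF \<open>x \<noteq> 0\<close>] Im_Ln_le_pi[OF \<open>x \<noteq> 0\<close>] by linarith
  moreover have "\<bar>pi * of_int j\<bar> \<le> pi * (real N - 1)"
    using j by (simp add: abs_mult)
  moreover have "Im w * real N = - (pi * of_int j) - Im (ln x)"
    using N by (simp add: w_def field_simps)
  ultimately have "\<bar>Im w * real N\<bar> < pi * real N"
    by (simp add: right_diff_distrib)
  then have Im_w: "\<bar>Im w\<bar> < pi" using N by (simp add: abs_mult)
  then have ln_w: "ln (dual_argument N x j) = w"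
    unfolding exp_w by (intro Ln_exp) auto
  then show "ln (dual_argument N x j) = - (\<i> * of_real pi * of_int j / of_nat N) - ln x / of_nat N"
    by (simp only: w_def)
  have "dual_argument N x j \<noteq> 0" by (simp add: exp_w)
  then show "dual_argument N x j \<notin> \<real>\<^sub>\<le>\<^sub>0"
    using Im_Ln_eq_pi[of "dual_argument N x j"] Im_w ln_w
    by (auto simp: complex_nonpos_Reals_iff complex_eq_iff)
qed

section \<open>Transformation of the double series\<close>

lemma reciprocal_diff_eq:
  fixes a :: "'a :: field"
  assumes "a \<noteq> 0" "w \<noteq> 0" "a + w \<noteq> 0"
  shows "1 / a - 1 / (a + w) = 1 / (a * (1 + a / w))"
  using assms by (simp add: field_simps)

lemma of_nat_add_of_real_mult_nonzero:
  fixes u :: complex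
  assumes "u \<notin> \<real>\<^sub>\<le>\<^sub>0" "t > 0"
  shows "of_nat (Suc m) + of_real t * u \<noteq> 0"
proof
  assume "of_nat (Suc m) + of_real t * u = 0"
  then have "real (Suc m) + t * Re u = 0" "t * Im u = 0"
    by (auto simp: complex_eq_iff)
  moreover from this have "t * Re u \<le> 0" by linarith
  ultimately show False
    using assms by (auto simp: complex_nonpos_Reals_iff mult_le_0_iff)
qed

lemma digamma_summand_eq:
  assumes "u \<notin> \<real>\<^sub>\<le>\<^sub>0"
  shows "digamma_summand p b u (n, m) = 1 / (of_real (real (Suc n) powr p) * of_nat (Suc m) *
    (1 + of_nat (Suc m) / (of_real (real (Suc n) powr b) * u)))"
proof -
  have "u \<noteq> 0" using assms by auto
  then show ?thesis
    unfolding digamma_summand_def prod.case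
    by (subst reciprocal_diff_eq)
      (use of_nat_add_of_real_mult_nonzero[OF assms] in \<open>simp_all add: mult_ac del: of_nat_Suc\<close>)
qed

lemma dual_digamma_summand_eq:
  fixes x :: complex and n m :: nat
  assumes "j \<in> balanced_indices N" "k > 0" "x \<notin> \<real>\<^sub>\<le>\<^sub>0"
  defines "X \<equiv> x powr (1 / of_nat N)"
  defines "y \<equiv> of_nat (Suc m) * X / of_real (real (Suc n) powr (1 / real N))"
  shows "X ^ (k - 1) * (minus_one_root N j ^ (k - 1) *
      digamma_summand (dual_exponent N k) (1 / real N) (dual_argument N x j) (n, m)) =
    1 / (of_nat (Suc m) ^ k * of_nat (Suc n)) *
      ((y * minus_one_root N j) ^ (k - 1) / (1 - y * minus_one_root N j))"
proof -
  define M s \<rho> where "M = (of_nat (Suc m) :: complex)"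
    and "s = complex_of_real (real (Suc n) powr (1 / real N))" and "\<rho> = minus_one_root N j"
  have "N > 0" using balanced_indicesD(1,2)[OF assms(1)] by linarith
  have nonzero: "M \<noteq> 0" "s \<noteq> 0" "X \<noteq> 0" "\<rho> \<noteq> 0"
    using assms(3) by (auto simp: M_def s_def X_def \<rho>_def minus_one_root_nonzero simp del: of_nat_Suc)
  have "M / (s * dual_argument N x j) = - (y * \<rho>)"
    using nonzero
    unfolding dual_argument_def y_def M_def[symmetric] s_def[symmetric] X_def[symmetric] \<rho>_def[symmetric]
    by simp
  then have "digamma_summand (dual_exponent N k) (1 / real N) (dual_argument N x j) (n, m) =
      1 / (of_nat (Suc n) * s ^ (k - 1) * M * (1 - y * \<rho>))"
    using assms(2) \<open>N > 0\<close>
    by (simp add: digamma_summand_eq dual_argument_not_nonpos[OF assms(1,3)] powr_dual_exponent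
        del: of_nat_Suc flip: M_def s_def)
  moreover have "X ^ (k - 1) = y ^ (k - 1) * s ^ (k - 1) / M ^ (k - 1)"
    using nonzero unfolding y_def M_def[symmetric] s_def[symmetric]
    by (simp add: power_mult_distrib power_divide)
  moreover have "M ^ k = M * M ^ (k - 1)"
    using assms(2) by (simp flip: power_Suc)
  ultimately show ?thesis
    unfolding M_def[symmetric] \<rho>_def[symmetric] using nonzero
    by (simp add: power_mult_distrib power_divide mult_ac)
qed

lemma digamma_summand_of_nat_eq:
  fixes m n N :: nat
  assumes "x \<notin> \<real>\<^sub>\<le>\<^sub>0"
  defines "v \<equiv> x * of_nat (Suc m) ^ N / of_nat (Suc n)"
  shows "v \<noteq> -1"
    and "digamma_summand (real k) (real N) x (m, n) =
      1 / (of_nat (Suc m) ^ k * of_nat (Suc n)) * (v / (1 + v))"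
proof -
  define M L where "M = (of_nat (Suc m) :: complex)" and "L = (of_nat (Suc n) :: complex)"
  have nonzero: "M \<noteq> 0" "L \<noteq> 0" "x \<noteq> 0"
    using assms(1) by (auto simp: M_def L_def simp del: of_nat_Suc)
  have v: "v = x * M ^ N / L" by (simp add: v_def M_def L_def)
  have "L + of_real (real (Suc m) ^ N) * x \<noteq> 0"
    unfolding L_def by (rule of_nat_add_of_real_mult_nonzero[OF assms(1)]) simp
  then have "L + M ^ N * x \<noteq> 0" by (simp add: M_def)
  then show "v \<noteq> -1"
    using nonzero by (auto simp: v field_simps add_eq_0_iff)
  have "digamma_summand (real k) (real N) x (m, n) = 1 / (M ^ k * L * (1 + L / (M ^ N * x)))"
    by (simp add: digamma_summand_eq[OF assms(1)] powr_realpow M_def L_def del: of_nat_Suc)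
  also have "1 + L / (M ^ N * x) = (1 + v) / v"
    using nonzero by (simp add: v field_simps)
  finally show "digamma_summand (real k) (real N) x (m, n) =
      1 / (of_nat (Suc m) ^ k * of_nat (Suc n)) * (v / (1 + v))"
    by (simp add: M_def L_def)
qed

lemma power_of_scaled_ratio:
  fixes M L x :: "'a :: field"
  assumes "M \<noteq> 0" "N * i \<le> k"
  shows "1 / (M ^ k * L) * (- (x * M ^ N / L)) ^ i =
    (- x) ^ i * (1 / L ^ (1 + i) * (1 / M ^ (k - N * i)))"
proof -
  have "M ^ k = M ^ (N * i) * M ^ (k - N * i)"
    using assms(2) by (simp flip: power_add)
  moreover have "(- (x * M ^ N / L)) ^ i = (- x) ^ i * M ^ (N * i) / L ^ i"
    unfolding power_mult power_mult_distrib[symmetric] power_divide[symmetric] by simp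
  ultimately show ?thesis
    using assms(1) by (simp add: mult_ac)
qed

lemma digamma_summand_transformation:
  fixes x :: complex
  assumes "N > 0" "k > 1" "x \<notin> \<real>\<^sub>\<le>\<^sub>0"
  defines "X \<equiv> x powr (1 / of_nat N)"
  shows "digamma_summand (real k) (real N) x (m, n) =
    - (X ^ (k - 1) / of_nat N) * (\<Sum>j\<in>balanced_indices N. minus_one_root N j ^ (k - 1) *
        digamma_summand (dual_exponent N k) (1 / real N) (dual_argument N x j) (n, m))
    - (\<Sum>i=1..(k - 2) div N.
        (- x) ^ i * (1 / of_nat (Suc n) ^ (1 + i) * (1 / of_nat (Suc m) ^ (k - N * i))))"
proof -
  define M L s where "M = (of_nat (Suc m) :: complex)" and "L = (of_nat (Suc n) :: complex)"
    and "s = complex_of_real (real (Suc n) powr (1 / real N))"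
  define y v where "y = M * X / s" and "v = x * M ^ N / L"
  have "x \<noteq> 0" using assms(3) by auto
  have "s ^ N = of_real ((real (Suc n) powr (1 / real N)) ^ N)" by (simp add: s_def)
  also have "\<dots> = L" using assms(1) by (simp add: L_def powr_power)
  finally have y_power: "y ^ N = v"
    using \<open>x \<noteq> 0\<close> assms(1)
    by (simp add: y_def v_def X_def power_divide power_mult_distrib powr_inverse_of_nat_power_self)
  have "v \<noteq> -1"
    unfolding v_def M_def L_def by (rule digamma_summand_of_nat_eq(1)[OF assms(3)])
  have "digamma_summand (real k) (real N) x (m, n) = 1 / (M ^ k * L) * (v / (1 + v))"
    unfolding v_def M_def L_def by (rule digamma_summand_of_nat_eq(2)[OF assms(3)])
  also have "v / (1 + v) = - (1 / of_nat N * (\<Sum>j\<in>balanced_indices N.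
        (y * minus_one_root N j) ^ (k - 1) / (1 - y * minus_one_root N j)))
      - (\<Sum>i=1..(k - 2) div N. (- v) ^ i)"
    using power_divide_one_plus_eq_root_sum[of N y "k - 2"] assms(1,2) \<open>v \<noteq> -1\<close>
    by (simp add: y_power Suc_diff_Suc numeral_2_eq_2 del: power_Suc)
  also have "1 / (M ^ k * L) * \<dots> = - (1 / of_nat N * (\<Sum>j\<in>balanced_indices N. 1 / (M ^ k * L) *
        ((y * minus_one_root N j) ^ (k - 1) / (1 - y * minus_one_root N j))))
      - (\<Sum>i=1..(k - 2) div N. 1 / (M ^ k * L) * (- v) ^ i)"
    unfolding sum_distrib_left[symmetric]
    by (simp only: right_diff_distrib mult_minus_right mult.left_commute)
  also have "(\<Sum>j\<in>balanced_indices N. 1 / (M ^ k * L) *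
        ((y * minus_one_root N j) ^ (k - 1) / (1 - y * minus_one_root N j))) =
      X ^ (k - 1) * (\<Sum>j\<in>balanced_indices N. minus_one_root N j ^ (k - 1) *
        digamma_summand (dual_exponent N k) (1 / real N) (dual_argument N x j) (n, m))"
    using assms(2) unfolding M_def L_def s_def y_def X_def sum_distrib_left
    by (intro sum.cong refl dual_digamma_summand_eq[symmetric] assms) auto
  also have "(\<Sum>i=1..(k - 2) div N. 1 / (M ^ k * L) * (- v) ^ i) =
      (\<Sum>i=1..(k - 2) div N. (- x) ^ i * (1 / L ^ (1 + i) * (1 / M ^ (k - N * i))))"
    unfolding v_def
    by (intro sum.cong refl power_of_scaled_ratio)
      (use assms(1) in
        \<open>auto simp: M_def less_eq_div_iff_mult_less_eq mult.commute simp del: of_nat_Suc\<close>)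
  finally show ?thesis
    unfolding M_def L_def by simp
qed

definition zeta_product_sum :: "nat \<Rightarrow> nat \<Rightarrow> complex \<Rightarrow> complex" where
  "zeta_product_sum N k x =
    (\<Sum>i=1..(k - 2) div N. (- x) ^ i * (zeta (of_nat (1 + i)) * zeta (of_nat (k - N * i))))"

lemma zeta_product_sum_has_sum:
  assumes "N > 0"
  shows "((\<lambda>(n, m). \<Sum>i=1..(k - 2) div N.
      (- x) ^ i * (1 / of_nat (Suc n) ^ (1 + i) * (1 / of_nat (Suc m) ^ (k - N * i)))) has_sum
    zeta_product_sum N k x) (UNIV \<times> UNIV)"
  unfolding zeta_product_sum_def case_prod_unfold
proof (intro has_sum_sum has_sum_cmult_right)
  fix i assume i: "i \<in> {1..(k - 2) div N}"
  then have "N * i \<le> k - 2"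
    using assms by (simp add: less_eq_div_iff_mult_less_eq mult.commute)
  moreover have "N * i > 0" using assms i by simp
  ultimately have "k - N * i > 1" by linarith
  then show "((\<lambda>z. 1 / of_nat (Suc (fst z)) ^ (1 + i) * (1 / of_nat (Suc (snd z)) ^ (k - N * i))) has_sum
      zeta (of_nat (1 + i)) * zeta (of_nat (k - N * i))) (UNIV \<times> UNIV)"
    using i has_sum_product[OF zeta_of_nat_has_sum zeta_of_nat_has_sum, of "1 + i" "k - N * i"]
    unfolding case_prod_unfold by simp
qed

lemma digamma_double_series_transformation:
  fixes x :: complex
  assumes "N > 0" "k > 1" "x \<notin> \<real>\<^sub>\<le>\<^sub>0"
  shows "digamma_double_series (real k) (real N) x =
    - ((x powr (1 / of_nat N)) ^ (k - 1) / of_nat N) *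
      (\<Sum>j\<in>balanced_indices N. minus_one_root N j ^ (k - 1) *
        digamma_double_series (dual_exponent N k) (1 / real N) (dual_argument N x j))
    - zeta_product_sum N k x"
proof (rule has_sum_unique)
  show "(digamma_summand (real k) (real N) x has_sum
      digamma_double_series (real k) (real N) x) (UNIV \<times> UNIV)"
    by (intro digamma_summand_has_sum) (use assms in auto)
  let ?c = "- ((x powr (1 / of_nat N)) ^ (k - 1) / of_nat N)"
  let ?dual = "\<lambda>j. digamma_summand (dual_exponent N k) (1 / real N) (dual_argument N x j)"
  have "((\<lambda>z. ?c * (\<Sum>j\<in>balanced_indices N. minus_one_root N j ^ (k - 1) * ?dual j z)
        + - (case z of (n, m) \<Rightarrow> \<Sum>i=1..(k - 2) div N.
          (- x) ^ i * (1 / of_nat (Suc n) ^ (1 + i) * (1 / of_nat (Suc m) ^ (k - N * i))))) has_sum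
      (?c * (\<Sum>j\<in>balanced_indices N. minus_one_root N j ^ (k - 1) *
          digamma_double_series (dual_exponent N k) (1 / real N) (dual_argument N x j))
        + - zeta_product_sum N k x)) (UNIV \<times> UNIV)"
    using assms
    by (intro has_sum_add has_sum_uminusI has_sum_cmult_right has_sum_sum digamma_summand_has_sum
        dual_argument_not_nonpos dual_exponent_gt_1 zeta_product_sum_has_sum) auto
  then show "(digamma_summand (real k) (real N) x has_sum
      ?c * (\<Sum>j\<in>balanced_indices N. minus_one_root N j ^ (k - 1) *
          digamma_double_series (dual_exponent N k) (1 / real N) (dual_argument N x j))
        - zeta_product_sum N k x) (UNIV \<times> UNIV)"
    by (subst has_sum_swap)
      (simp only: digamma_summand_transformation[OF assms] diff_conv_add_uminus
        case_prod_unfold prod.collapse)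
qed

section \<open>The residue term\<close>

lemma minus_one_root_power_mult_dual_correction:
  fixes x :: complex
  assumes "j \<in> balanced_indices N" "k > 0" "x \<notin> \<real>\<^sub>\<le>\<^sub>0"
  shows "minus_one_root N j ^ (k - 1) * herglotz_correction p (1 / real N) (dual_argument N x j) =
    (deriv zeta (of_real p) / of_nat N - (euler_mascheroni - ln x / of_nat N) * zeta (of_real p))
      * minus_one_root N j ^ (k - 1)
    + \<i> * of_real pi / of_nat N * zeta (of_real p) * (of_int j * minus_one_root N j ^ (k - 1))
    + x powr (1 / of_nat N) / 2 * zeta (of_real (p + 1 / real N)) * minus_one_root N j ^ k"
proof -
  have "minus_one_root N j ^ k = minus_one_root N j ^ (k - 1) * minus_one_root N j"
    using assms(2) by (simp flip: power_Suc2)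
  then show ?thesis
    unfolding herglotz_correction_def Ln_dual_argument[OF assms(1,3)]
    by (simp add: dual_argument_def algebra_simps)
qed

lemma sum_dual_correction:
  fixes x :: complex
  assumes "N > 0" "k > 1" "x \<notin> \<real>\<^sub>\<le>\<^sub>0"
  shows "(\<Sum>j\<in>balanced_indices N. minus_one_root N j ^ (k - 1) *
      herglotz_correction p (1 / real N) (dual_argument N x j)) =
    (if N dvd k - 1
     then - ((-1) ^ ((k - 1) div N) *
       ((of_nat N * euler_mascheroni - ln x) * zeta (of_real p) - deriv zeta (of_real p)))
     else of_real pi * zeta (of_real p) / of_real (sin (pi * of_nat (k - 1) / of_nat N)))
    + (if N dvd k
       then of_nat N / 2 * (-1) ^ (k div N) * x powr (1 / of_nat N) * zeta (of_real (p + 1 / real N))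
       else 0)"
proof -
  define A B C where
    "A = deriv zeta (of_real p) / of_nat N - (euler_mascheroni - ln x / of_nat N) * zeta (of_real p)"
    and "B = \<i> * of_real pi / of_nat N * zeta (of_real p)"
    and "C = x powr (1 / of_nat N) / 2 * zeta (of_real (p + 1 / real N))"
  have "(\<Sum>j\<in>balanced_indices N. minus_one_root N j ^ (k - 1) *
        herglotz_correction p (1 / real N) (dual_argument N x j)) =
      (\<Sum>j\<in>balanced_indices N. A * minus_one_root N j ^ (k - 1)
        + B * (of_int j * minus_one_root N j ^ (k - 1)) + C * minus_one_root N j ^ k)"
    unfolding A_def B_def C_def
    by (intro sum.cong refl minus_one_root_power_mult_dual_correction) (use assms in auto)
  then have "(\<Sum>j\<in>balanced_indices N. minus_one_root N j ^ (k - 1) *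
        herglotz_correction p (1 / real N) (dual_argument N x j)) =
      A * (\<Sum>j\<in>balanced_indices N. minus_one_root N j ^ (k - 1))
      + B * (\<Sum>j\<in>balanced_indices N. of_int j * minus_one_root N j ^ (k - 1))
      + C * (\<Sum>j\<in>balanced_indices N. minus_one_root N j ^ k)"
    by (simp add: sum.distrib sum_distrib_left)
  moreover have "A * (\<Sum>j\<in>balanced_indices N. minus_one_root N j ^ (k - 1)) =
      (if N dvd k - 1 then - ((-1) ^ ((k - 1) div N) *
         ((of_nat N * euler_mascheroni - ln x) * zeta (of_real p) - deriv zeta (of_real p))) else 0)"
    using assms(1) by (simp add: A_def sum_minus_one_root_power field_simps del: One_nat_def)
  moreover have "B * (\<Sum>j\<in>balanced_indices N. of_int j * minus_one_root N j ^ (k - 1)) =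
      (if N dvd k - 1 then 0
       else of_real pi * zeta (of_real p) / of_real (sin (pi * of_nat (k - 1) / of_nat N)))"
    using assms(1) by (simp add: B_def sum_of_int_minus_one_root_power field_simps del: One_nat_def)
  moreover have "C * (\<Sum>j\<in>balanced_indices N. minus_one_root N j ^ k) =
      (if N dvd k
       then of_nat N / 2 * (-1) ^ (k div N) * x powr (1 / of_nat N) * zeta (of_real (p + 1 / real N))
       else 0)"
    using assms(1) by (simp add: C_def sum_minus_one_root_power)
  ultimately show ?thesis by simp
qed

lemma pred_div_eq:
  fixes k N :: nat
  assumes "k > 1"
  shows "(k - 2) div N = (if N dvd k - 1 then (k - 1) div N - 1 else (k - 1) div N)"
proof -
  have "k - 1 = Suc (k - 2)" using assms by simp
  then show ?thesis by (simp add: div_Suc dvd_eq_mod_eq_0)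
qed

lemma zeta_product_sum_divide:
  assumes "N > 0"
  shows "zeta_product_sum N k x / P = (\<Sum>i=1..(k - 2) div N. (-1) ^ i * zeta (1 + of_nat i) *
    zeta (of_nat k - of_nat N * of_nat i) * (x ^ i / P))"
  unfolding zeta_product_sum_def sum_divide_distrib
proof (rule sum.cong[OF refl])
  fix i assume "i \<in> {1..(k - 2) div N}"
  then have "N * i \<le> k - 2"
    using assms by (simp add: less_eq_div_iff_mult_less_eq mult.commute)
  then have "of_nat (k - N * i) = (of_nat k - of_nat N * of_nat i :: complex)"
    by (simp add: of_nat_diff)
  then show "(- x) ^ i * (zeta (of_nat (1 + i)) * zeta (of_nat (k - N * i))) / P =
      (-1) ^ i * zeta (1 + of_nat i) * zeta (of_nat k - of_nat N * of_nat i) * (x ^ i / P)"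
    by (simp add: power_minus[of x] mult_ac)
qed

lemma herglotz_residue_eq:
  fixes x :: complex
  assumes "N > 1" "k > 1" "x \<notin> \<real>\<^sub>\<le>\<^sub>0"
  defines "P \<equiv> x powr ((of_nat k - 1) / of_nat N)"
  shows "herglotz_residue N k x =
    of_nat N / P * (zeta_product_sum N k x - herglotz_correction (real k) (real N) x)
    - (\<Sum>j\<in>balanced_indices N. minus_one_root N j ^ (k - 1) *
        herglotz_correction (dual_exponent N k) (1 / real N) (dual_argument N x j))"
proof -
  have N: "N > 0" using assms(1) by simp
  have "x \<noteq> 0" using assms(3) by auto
  then have "P \<noteq> 0" by (simp add: P_def)
  have "(1 - of_nat k) / of_nat N = - ((of_nat k - 1) / of_nat N :: complex)"
    by (simp add: diff_divide_distrib)
  then have powr_inverse: "x powr ((1 - of_nat k) / of_nat N) = 1 / P"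
    by (simp add: P_def powr_minus inverse_eq_divide)
  have powr_inverse_N: "x powr ((1 - of_nat k - of_nat N) / of_nat N) = 1 / (P * x)"
    using N \<open>x \<noteq> 0\<close> powr_inverse by (simp add: diff_divide_distrib[of _ "of_nat N"] powr_diff)
  have powr_inverse_add: "x powr ((1 - of_nat k) / of_nat N + of_nat i) = x ^ i / P" for i
    using \<open>x \<noteq> 0\<close> by (simp add: powr_add powr_inverse)
  have "of_real pi / of_nat N * (of_nat k - 1) = complex_of_real (pi * real (k - 1) / real N)"
    using assms(2) by (simp add: of_nat_diff)
  then have sine: "sin (of_real pi / of_nat N * (of_nat k - 1)) =
      complex_of_real (sin (pi * real (k - 1) / real N))"
    by (simp only: sin_of_real)
  have zeta_terms: "of_nat N / P * (zeta_product_sum N k x - herglotz_correction (real k) (real N) x) =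
      of_nat N / 2 * (1 / (P * x)) * zeta (of_nat k + of_nat N)
      - of_nat N * (1 / P) *
        (of_nat N * deriv zeta (of_nat k) - (euler_mascheroni + ln x) * zeta (of_nat k))
      + of_nat N * (zeta_product_sum N k x / P)"
    using \<open>x \<noteq> 0\<close> \<open>P \<noteq> 0\<close> by (simp add: herglotz_correction_def field_simps)
  have not_dvd: "\<not> N dvd k" if "N dvd k - 1"
    using that assms(1,2) dvd_diff_nat[of N k "k - 1"] by auto
  show ?thesis
    unfolding zeta_terms sum_dual_correction[OF N assms(2,3)]
      zeta_product_sum_divide[OF N] pred_div_eq[OF assms(2)] herglotz_residue_def
      powr_inverse powr_inverse_N powr_inverse_add sine of_real_dual_exponent of_real_dual_exponent_add
    using not_dvd
    by (simp only: diff_conv_add_uminus minus_add_distrib minus_minus minus_zero add_0_right add_ac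
        split: if_split) simp
qed

section \<open>The transformation formula\<close>

theorem herglotz_transformation:
  fixes x :: complex
  assumes "N > 1" "k > 1" "x \<notin> \<real>\<^sub>\<le>\<^sub>0"
  defines "P \<equiv> x powr ((of_nat k - 1) / of_nat N)"
  shows "herglotz (real k) (real N) x =
    - (P / of_nat N) * (\<Sum>j\<in>balanced_indices N. minus_one_root N j ^ (k - 1) *
        herglotz (dual_exponent N k) (1 / real N) (dual_argument N x j))
    - P / of_nat N * herglotz_residue N k x"
proof -
  define S C where "S = (\<Sum>j\<in>balanced_indices N. minus_one_root N j ^ (k - 1) *
      digamma_double_series (dual_exponent N k) (1 / real N) (dual_argument N x j))"
    and "C = (\<Sum>j\<in>balanced_indices N. minus_one_root N j ^ (k - 1) *
      herglotz_correction (dual_exponent N k) (1 / real N) (dual_argument N x j))"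
  have "x \<noteq> 0" using assms(3) by auto
  then have "P \<noteq> 0" by (simp add: P_def)
  have P: "(x powr (1 / of_nat N)) ^ (k - 1) = P"
    using assms(2) powr_of_nat_divide[OF \<open>x \<noteq> 0\<close>, of "k - 1" N] by (simp add: P_def of_nat_diff)
  have "herglotz (real k) (real N) x =
      - (P / of_nat N) * S - zeta_product_sum N k x + herglotz_correction (real k) (real N) x"
    using assms(1-3)
    by (simp add: herglotz_eq_double_series digamma_double_series_transformation P S_def
        del: One_nat_def)
  also have "\<dots> = - (P / of_nat N) * (S + C) - P / of_nat N * herglotz_residue N k x"
    unfolding herglotz_residue_eq[OF assms(1-3), folded P_def C_def]
    using assms(1) \<open>P \<noteq> 0\<close> by (simp add: field_simps)
  also have "S + C = (\<Sum>j\<in>balanced_indices N. minus_one_root N j ^ (k - 1) *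
      herglotz (dual_exponent N k) (1 / real N) (dual_argument N x j))"
    unfolding S_def C_def sum.distrib[symmetric] distrib_left[symmetric]
    by (intro sum.cong refl arg_cong2[where f = "(*)"] herglotz_eq_double_series[symmetric]
        dual_exponent_gt_1 dual_argument_not_nonpos assms) (use assms(1) in auto)
  finally show ?thesis .
qed

theorem theorem2p5:
  fixes k N :: nat and x :: complex
  assumes "k > 1" and "N > 1" and "Re x > 0"
  shows "herglotz (real k) (real N) x =
    (-1) ^ k / of_nat N * x powr ((of_nat k - 1) / of_nat N) *
      (\<Sum>j | j \<in> {- (int N - 1)..int N - 1} \<and> [j = int N - 1] (mod 2).
         exp (\<i> * of_real pi * of_int j * (of_nat k - 1) / of_nat N) *
         herglotz ((real N + real k - 1) / real N) (1 / real N)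
           (exp (- (\<i> * of_real pi * of_int j / of_nat N)) / x powr (1 / of_nat N)))
    - x powr ((of_nat k - 1) / of_nat N) / of_nat N * herglotz_residue N k x"
proof -
  let ?dual = "\<lambda>j. herglotz (dual_exponent N k) (1 / real N) (dual_argument N x j)"
  let ?weight = "\<lambda>j. exp (\<i> * of_real pi * of_int j * (of_nat k - 1) / of_nat N)"
  have "x \<notin> \<real>\<^sub>\<le>\<^sub>0" using assms(3) by (auto simp: complex_nonpos_Reals_iff)
  then have "herglotz (real k) (real N) x = - (x powr ((of_nat k - 1) / of_nat N) / of_nat N) *
        (\<Sum>j\<in>balanced_indices N. minus_one_root N j ^ (k - 1) * ?dual j)
      - x powr ((of_nat k - 1) / of_nat N) / of_nat N * herglotz_residue N k x"
    using assms(1,2) by (intro herglotz_transformation)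
  also have "(\<Sum>j\<in>balanced_indices N. minus_one_root N j ^ (k - 1) * ?dual j) =
      - ((-1) ^ k * (\<Sum>j\<in>balanced_indices N. ?weight j * ?dual j))"
    using assms(1)
    by (simp add: minus_one_root_power_eq_exp sum_distrib_left sum_negf mult.assoc del: One_nat_def)
  finally show ?thesis
    unfolding exp_divide_powr_eq_dual_argument dual_exponent_def[symmetric]
      balanced_indices_def[symmetric]
    by simp
qed

end
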